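(* Let $H=H(b,\delta,\lambda)$ be a balanced HST with root $\rho$, and let $W$ be a random $n$-element submultiset of its leaves. Then the expected cost of a minimum-cost tour on $W\cup\{\rho\}$ is \[2\sum_{\ell=1}^{\delta}\Big[(b\lambda)^\ell\Big(1-\Big(1-\frac{1}{b^\ell}\Big)^n\Big)\Big].\]
   Context: A balanced HST $H(b,\delta,\lambda)$ (integers $b\ge2$, $\delta\ge1$, real $0<\lambda<1$) is a rooted tree in which every non-leaf vertex has exactly $b$ children and every leaf is at depth $\delta$; the root is at level $0$, and each edge joining a vertex at level $\ell-1$ to a child at level $\ell$ has weight $\lambda^\ell$. The distance $d_H(x,y)$ is the total weight of the tree path between $x$ and $y$. A random $n$-element submultiset of the leaves is obtained by choosing $n$ leaves independently and uniformly at random (repetitions allowed); copies of the same leaf are treated as distinct points at distance $0$. A tour on a multiset of vertices is a Hamiltonian cycle in the complete graph on it, with cost the sum of $d_H$ over its edges. *)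

theory Defs
  imports "HOL-Probability.Probability" "HOL-Combinatorics.Multiset_Permutations"
begin

text \<open>
  The tree \<open>H(b, \<delta>, \<lambda>)\<close> is modelled by words: a vertex at level \<open>\<ell>\<close> is a word of length
  \<open>\<ell>\<close> over \<open>{0, \<dots>, b - 1}\<close>, namely the sequence of child numbers on the way
  down from the root \<open>[]\<close>. The children of \<open>v\<close> are the words \<open>v @ [i]\<close>.
  The parameter \<open>\<lambda>\<close> is written \<open>lam\<close>.
\<close>

definition hst_vertices :: "nat \<Rightarrow> nat \<Rightarrow> nat list set" where
  "hst_vertices b \<delta> = {v. set v \<subseteq> {..<b} \<and> length v \<le> \<delta>}"

definition hst_root :: "nat list" where
  "hst_root = []"

definition hst_leaves :: "nat \<Rightarrow> nat \<Rightarrow> nat list set" where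
  "hst_leaves b \<delta> = {v \<in> hst_vertices b \<delta>. length v = \<delta>}"

definition hst_adj :: "nat \<Rightarrow> nat \<Rightarrow> nat list \<Rightarrow> nat list \<Rightarrow> bool" where
  "hst_adj b \<delta> u v \<longleftrightarrow> u \<in> hst_vertices b \<delta> \<and> v \<in> hst_vertices b \<delta> \<and>
     (\<exists>i. v = u @ [i] \<or> u = v @ [i])"

text \<open>On adjacent vertices the maximum is the level of the child.\<close>

definition hst_edge_weight :: "real \<Rightarrow> nat list \<Rightarrow> nat list \<Rightarrow> real" where
  "hst_edge_weight lam u v = lam ^ max (length u) (length v)"

definition hst_path :: "nat \<Rightarrow> nat \<Rightarrow> nat list \<Rightarrow> nat list \<Rightarrow> nat list list \<Rightarrow> bool" where
  "hst_path b \<delta> x y p \<longleftrightarrow> p \<noteq> [] \<and> hd p = x \<and> last p = y \<and> distinct p \<and>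
     set p \<subseteq> hst_vertices b \<delta> \<and> successively (hst_adj b \<delta>) p"

definition hst_path_weight :: "real \<Rightarrow> nat list list \<Rightarrow> real" where
  "hst_path_weight lam p = (\<Sum>i<length p - 1. hst_edge_weight lam (p ! i) (p ! Suc i))"

definition hst_dist :: "nat \<Rightarrow> nat \<Rightarrow> real \<Rightarrow> nat list \<Rightarrow> nat list \<Rightarrow> real" where
  "hst_dist b \<delta> lam x y = hst_path_weight lam (THE p. hst_path b \<delta> x y p)"

text \<open>
  A Hamiltonian cycle on a multiset of points is given by a cyclic enumeration of it, that is, by
  a list in which every point occurs with its multiplicity; the last entry is joined to the first.
  In particular, a tour on two points uses the edge between them twice, and a tour on one
  point costs its distance to itself.
\<close>

definition tour_cost :: "('a \<Rightarrow> 'a \<Rightarrow> real) \<Rightarrow> 'a list \<Rightarrow> real" where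
  "tour_cost d xs = (\<Sum>i<length xs. d (xs ! i) (xs ! (Suc i mod length xs)))"

definition min_tour_cost :: "('a \<Rightarrow> 'a \<Rightarrow> real) \<Rightarrow> 'a multiset \<Rightarrow> real" where
  "min_tour_cost d M = Min (tour_cost d ` permutations_of_multiset M)"

definition random_leaves :: "nat \<Rightarrow> nat \<Rightarrow> nat \<Rightarrow> nat list multiset pmf" where
  "random_leaves b \<delta> n = map_pmf mset (replicate_pmf n (pmf_of_set (hst_leaves b \<delta>)))"

end

theory Submission
  imports Defs "HOL-Library.List_Lexorder" "HOL-Library.Sublist"
begin

text \<open>
  Name an edge by its lower endpoint \<open>v\<close>. It lies on the path between \<open>x\<close> and \<open>y\<close> iff exactly
  one of them extends the word \<open>v\<close>, so the cost of a tour is the sum over \<open>v \<noteq> []\<close> of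
  \<open>lam ^ length v\<close> times the number of times the tour enters or leaves the subtree below \<open>v\<close>.
  As the root lies outside, this number is at least 2 whenever the subtree contains a
  point of \<open>W\<close>. The lexicographic tour attains all these bounds simultaneously, since subtrees
  are order-convex. The expectation then follows by linearity, as each of the \<open>b ^ l\<close> subtrees at
  level \<open>l\<close> is missed with probability \<open>(1 - 1 / b ^ l) ^ n\<close>.
\<close>

section \<open>Distances\<close>

lemma finite_hst_vertices: "finite (hst_vertices b \<delta>)"
  unfolding hst_vertices_def by (rule finite_lists_length_le) simp

lemma hst_vertices_prefix:
  assumes "y \<in> hst_vertices b \<delta>" "prefix x y"
  shows "x \<in> hst_vertices b \<delta>"
  using assms by (auto simp: hst_vertices_def prefix_def)

lemma not_prefix_butlast: "v \<noteq> [] \<Longrightarrow> \<not> prefix v (butlast v)"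
  by (metis length_butlast prefix_length_le diff_less length_greater_0_conv less_one linorder_not_le)

lemma hst_adj_sym: "hst_adj b \<delta> u v \<longleftrightarrow> hst_adj b \<delta> v u"
  by (auto simp: hst_adj_def)

lemma hst_adj_butlast:
  assumes "v \<in> hst_vertices b \<delta>" "v \<noteq> []"
  shows "hst_adj b \<delta> (butlast v) v"
proof -
  have "v = butlast v @ [last v]"
    using assms(2) by simp
  then show ?thesis
    unfolding hst_adj_def
    using assms(1) hst_vertices_prefix[OF assms(1) prefixeq_butlast] by blast
qed

lemma hst_adj_cases:
  assumes "hst_adj b \<delta> u v"
  obtains "u \<noteq> []" "v = butlast u" | "v \<noteq> []" "u = butlast v"
  using assms by (auto simp: hst_adj_def)

text \<open>Adjacent words differ by one final letter, so the longer word is its only prefix that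
  the shorter one lacks. Hence a single edge crosses the boundary of the subtree below
  \<open>v\<close>: the one with lower endpoint \<open>v\<close>.\<close>

lemma hst_adj_prefix_neq:
  assumes "hst_adj b \<delta> u w" "prefix v u \<noteq> prefix v w"
  shows "u = v \<and> w = butlast v \<or> w = v \<and> u = butlast v"
  using assms by (auto simp: hst_adj_def)

text \<open>Some step of the walk must change sides with respect to the subtree below
  \<open>v\<close>, and only the edge between \<open>butlast v\<close> and \<open>v\<close> does
  so.\<close>

lemma hst_walk_prefix_neq:
  assumes "successively (hst_adj b \<delta>) p" "p \<noteq> []" "prefix v (hd p) \<noteq> prefix v (last p)"
  shows "v \<in> set p \<and> butlast v \<in> set p"
  using assms
proof (induction p)
  case (Cons x p)
  show ?case
  proof (cases p)
    case (Cons a q)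
    with Cons.prems have walk: "hst_adj b \<delta> x a" "successively (hst_adj b \<delta>) p"
      by auto
    show ?thesis
    proof (cases "prefix v x = prefix v a")
      case True
      then show ?thesis
        using Cons Cons.prems Cons.IH walk by auto
    next
      case False
      then show ?thesis
        using hst_adj_prefix_neq[OF walk(1)] Cons by auto
    qed
  qed (use Cons.prems in simp)
qed simp

section \<open>Uniqueness and existence of paths\<close>

lemma hst_path_Cons_Cons:
  "hst_path b \<delta> x y (u # a # p) \<longleftrightarrow>
     u = x \<and> hst_adj b \<delta> x a \<and> x \<notin> set (a # p) \<and> hst_path b \<delta> a y (a # p)"
  by (auto simp: hst_path_def hst_adj_def)

lemma hst_path_singleton:
  "hst_path b \<delta> x y [u] \<longleftrightarrow> u = x \<and> y = x \<and> x \<in> hst_vertices b \<delta>"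
  by (auto simp: hst_path_def)

text \<open>Separation in contrapositive form: a path that misses an endpoint of the edge above
  \<open>v\<close> cannot leave or enter the subtree below \<open>v\<close>.\<close>

lemma hst_path_prefix_eq:
  assumes "hst_path b \<delta> x y p" "v \<notin> set p \<or> butlast v \<notin> set p"
  shows "prefix v x \<longleftrightarrow> prefix v y"
  using hst_walk_prefix_neq[of b \<delta> p v] assms by (auto simp: hst_path_def)

text \<open>
  Of two distinct neighbours of \<open>x\<close>, one is a child \<open>a\<close> of \<open>x\<close>. The path
  through \<open>a\<close> that avoids \<open>x\<close> stays below \<open>a\<close>, and the other one stays outside.
\<close>

lemma hst_path_first_step_unique_aux:
  assumes a: "hst_adj b \<delta> x a" "x = butlast a" "a \<noteq> []" "hst_path b \<delta> a y p" "x \<notin> set p"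
    and c: "hst_adj b \<delta> x c" "hst_path b \<delta> c y q" "x \<notin> set q"
  shows "a = c"
proof -
  have "prefix a a \<longleftrightarrow> prefix a y"
    using hst_path_prefix_eq[OF a(4)] a(2,5) by blast
  moreover have "prefix a c \<longleftrightarrow> prefix a y"
    using hst_path_prefix_eq[OF c(2)] a(2) c(3) by blast
  moreover have "\<not> prefix a x"
    using a(2,3) by (simp add: not_prefix_butlast)
  ultimately show ?thesis
    using hst_adj_prefix_neq[OF c(1), of a] a(2,3) by auto
qed

lemma hst_path_first_step_unique:
  assumes a: "hst_adj b \<delta> x a" "hst_path b \<delta> a y p" "x \<notin> set p"
    and c: "hst_adj b \<delta> x c" "hst_path b \<delta> c y q" "x \<notin> set q"
  shows "a = c"
  using a(1)
proof (cases rule: hst_adj_cases)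
  case 1
  note a_parent = this
  from c(1) show ?thesis
  proof (cases rule: hst_adj_cases)
    case 1
    then show ?thesis using a_parent by simp
  next
    case 2
    then show ?thesis
      using hst_path_first_step_unique_aux[OF c(1) _ _ c(2,3) a] by simp
  qed
next
  case 2
  then show ?thesis
    using hst_path_first_step_unique_aux[OF a(1) _ _ a(2,3) c] by simp
qed

text \<open>Two paths with at least one edge take the same first step, because their tails avoid
  \<open>x\<close>; induction then identifies the tails.\<close>

lemma hst_path_unique:
  assumes "hst_path b \<delta> x y p" "hst_path b \<delta> x y q"
  shows "p = q"
  using assms
proof (induction p arbitrary: x q)
  case Nil
  then show ?case by (simp add: hst_path_def)
next
  case (Cons u p)
  obtain w q' where q: "q = w # q'"
    using Cons.prems(2) by (cases q) (auto simp: hst_path_def)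
  show ?case
  proof (cases "p = [] \<or> q' = []")
    case True
    then have "x = y"
      using Cons.prems q by (auto simp: hst_path_singleton)
    \<comment> \<open>A longer list from \<open>x\<close> to \<open>x\<close> would contain
      \<open>x\<close> both first and last, against distinctness.\<close>
    moreover have "r = [x]" if "hst_path b \<delta> x x r" for r
    proof (cases r)
      case (Cons z r')
      then show ?thesis
        using that by (cases r' rule: rev_cases) (auto simp: hst_path_def)
    qed (use that in \<open>simp add: hst_path_def\<close>)
    ultimately show ?thesis
      using Cons.prems by metis
  next
    case False
    then obtain a p' c q'' where pq: "p = a # p'" "q' = c # q''"
      by (auto simp: neq_Nil_conv)
    from Cons.prems have *: "hst_adj b \<delta> x a" "hst_path b \<delta> a y p" "x \<notin> set p"
      "hst_adj b \<delta> x c" "hst_path b \<delta> c y q'" "x \<notin> set q'" "u = x" "w = x"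
      unfolding q pq hst_path_Cons_Cons by auto
    then have "a = c"
      by (metis hst_path_first_step_unique)
    then show ?thesis
      using Cons.IH * q by blast
  qed
qed

text \<open>The path is built by dropping last letters of \<open>x\<close> until a prefix of
  \<open>y\<close> is reached, then by growing that prefix to \<open>y\<close>. The prefix condition
  strengthens the induction: it shows that the vertex being added is not yet on the path.\<close>

lemma hst_path_exists:
  assumes "x \<in> hst_vertices b \<delta>" "y \<in> hst_vertices b \<delta>"
  shows "\<exists>p. hst_path b \<delta> x y p \<and> (\<forall>v\<in>set p. prefix v x \<or> prefix v y)"
  using assms
proof (induction "length x + length y" arbitrary: x y rule: less_induct)
  case less
  show ?case
  proof (cases "prefix x y")
    case False
    then have x: "x \<noteq> []"
      by auto
    have "butlast x \<in> hst_vertices b \<delta>"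
      using less.prems(1) hst_vertices_prefix prefixeq_butlast by blast
    moreover have "length (butlast x) + length y < length x + length y"
      using x by simp
    ultimately obtain p where p: "hst_path b \<delta> (butlast x) y p"
      "\<forall>v\<in>set p. prefix v (butlast x) \<or> prefix v y"
      using less.hyps[of "butlast x" y] less.prems(2) by blast
    have "\<not> prefix x (butlast x)"
      using x by (simp add: not_prefix_butlast)
    then have "x \<notin> set p"
      using p(2) False by blast
    moreover obtain p' where "p = butlast x # p'"
      using p(1) by (cases p) (auto simp: hst_path_def)
    ultimately have "hst_path b \<delta> x y (x # p)"
      using p(1) hst_adj_butlast[OF less.prems(1) x]
      by (simp add: hst_path_Cons_Cons hst_adj_sym)
    moreover have "\<forall>v\<in>set (x # p). prefix v x \<or> prefix v y"
      using p(2) prefixeq_butlast prefix_order.trans by fastforce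
    ultimately show ?thesis
      by blast
  next
    case True
    show ?thesis
    proof (cases "x = y")
      case True
      then show ?thesis
        using less.prems by (intro exI[of _ "[x]"]) (simp add: hst_path_singleton)
    next
      case False
      with True have y: "y \<noteq> []" "\<not> prefix y x"
        by (auto dest: prefix_order.antisym)
      have "butlast y \<in> hst_vertices b \<delta>"
        using less.prems(2) hst_vertices_prefix prefixeq_butlast by blast
      moreover have "length x + length (butlast y) < length x + length y"
        using y by simp
      ultimately obtain p where p: "hst_path b \<delta> x (butlast y) p"
        "\<forall>v\<in>set p. prefix v x \<or> prefix v (butlast y)"
        using less.hyps[of x "butlast y"] less.prems(1) by blast
      have "\<not> prefix y (butlast y)"
        using y(1) by (simp add: not_prefix_butlast)
      then have "y \<notin> set p"
        using p(2) y(2) by blast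
      then have "hst_path b \<delta> x y (p @ [y])"
        using p(1) hst_adj_butlast[OF less.prems(2) y(1)] less.prems(2)
        by (auto simp: hst_path_def successively_append_iff)
      moreover have "\<forall>v\<in>set (p @ [y]). prefix v x \<or> prefix v y"
        using p(2) prefixeq_butlast prefix_order.trans by fastforce
      ultimately show ?thesis
        by blast
    qed
  qed
qed

section \<open>The distance as a sum over separating edges\<close>

text \<open>Induction along the path: its first edge contributes exactly the summand of its lower
  endpoint \<open>e\<close>, and for every other \<open>v\<close> the vertices \<open>x\<close> and
  \<open>a\<close> lie on the same side.\<close>

lemma hst_path_weight_eq:
  assumes "hst_path b \<delta> x y p"
  shows "hst_path_weight lam p =
    (\<Sum>v\<in>hst_vertices b \<delta> - {[]}. lam ^ length v * of_bool (prefix v x \<noteq> prefix v y))"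
    (is "_ = ?D x y")
  using assms
proof (induction p arbitrary: x)
  case Nil
  then show ?case by (simp add: hst_path_def)
next
  case (Cons u p)
  show ?case
  proof (cases p)
    case Nil
    then show ?thesis
      using Cons.prems by (simp add: hst_path_singleton hst_path_weight_def)
  next
    case (Cons a q)
    with Cons.prems have *: "u = x" "hst_adj b \<delta> x a" "x \<notin> set p" "hst_path b \<delta> a y p"
      by (simp_all add: hst_path_Cons_Cons)
    \<comment> \<open>\<open>e\<close> is whichever of \<open>x\<close> and \<open>a\<close> is the
      child; its length is the exponent in the edge weight.\<close>
    obtain e where e: "e \<noteq> []" "x = e \<and> a = butlast e \<or> a = e \<and> x = butlast e" "length e = max (length x) (length a)"
    proof -
      from *(2) show ?thesis
      proof (cases rule: hst_adj_cases)
        case 1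
        then show ?thesis by (intro that[of x]) auto
      next
        case 2
        then show ?thesis by (intro that[of a]) auto
      qed
    qed
    have not_below: "\<not> prefix e (butlast e)"
      using e(1) by (simp add: not_prefix_butlast)
    have e_vertex: "e \<in> hst_vertices b \<delta>"
      using *(2) e(2) unfolding hst_adj_def by metis
    have sep_xa: "prefix v x \<noteq> prefix v a \<longleftrightarrow> v = e" for v
    proof
      assume "prefix v x \<noteq> prefix v a"
      then have "x = v \<and> a = butlast v \<or> a = v \<and> x = butlast v"
        by (rule hst_adj_prefix_neq[OF *(2)])
      then show "v = e"
        using e(2) not_below prefixeq_butlast by metis
    next
      assume "v = e"
      then show "prefix v x \<noteq> prefix v a"
        using e(2) not_below by auto
    qed
    \<comment> \<open>The rest of the path avoids \<open>x\<close>, an endpoint of the edge above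
      \<open>e\<close>, so it never crosses that edge again.\<close>
    have sep_ay: "prefix e a \<longleftrightarrow> prefix e y"
      using hst_path_prefix_eq[OF *(4), of e] *(3) e(2) by metis
    have "?D x y = (\<Sum>v\<in>hst_vertices b \<delta> - {[]}.
        (if v = e then lam ^ length v else 0) + lam ^ length v * of_bool (prefix v a \<noteq> prefix v y))"
      using sep_xa sep_ay by (intro sum.cong) auto
    also have "\<dots> = lam ^ length e + ?D a y"
      using e(1) e_vertex by (simp add: sum.distrib finite_hst_vertices)
    also have "\<dots> = hst_edge_weight lam x a + hst_path_weight lam p"
      using Cons.IH[OF *(4)] e(3) by (simp add: hst_edge_weight_def)
    also have "\<dots> = hst_path_weight lam (u # p)"
      unfolding hst_path_weight_def Cons *(1) by (simp add: sum.lessThan_Suc_shift del: sum.lessThan_Suc)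
    finally show ?thesis ..
  qed
qed

lemma hst_dist_eq:
  assumes "x \<in> hst_vertices b \<delta>" "y \<in> hst_vertices b \<delta>"
  shows "hst_dist b \<delta> lam x y =
    (\<Sum>v\<in>hst_vertices b \<delta> - {[]}. lam ^ length v * of_bool (prefix v x \<noteq> prefix v y))"
proof -
  obtain p where p: "hst_path b \<delta> x y p"
    using hst_path_exists[OF assms] by blast
  then have "(THE q. hst_path b \<delta> x y q) = p"
    using hst_path_unique by blast
  then show ?thesis
    using hst_path_weight_eq[OF p] by (simp add: hst_dist_def)
qed

section \<open>Optimal tours\<close>

text \<open>An index stands for the step from that entry to its cyclic successor. Counting indices
  keeps repeated points and repeated edges apart.\<close>

definition cyclic_changes :: "('a \<Rightarrow> bool) \<Rightarrow> 'a list \<Rightarrow> nat set" where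
  "cyclic_changes P xs = {i. i < length xs \<and> P (xs ! i) \<noteq> P (xs ! (Suc i mod length xs))}"

lemma finite_cyclic_changes: "finite (cyclic_changes P xs)"
  by (simp add: cyclic_changes_def)

text \<open>Otherwise \<open>P\<close> would propagate from one index to its successor all the way
  round the cycle.\<close>

lemma cyclic_change_exists:
  assumes "x \<in> set xs" "P x" "y \<in> set xs" "\<not> P y"
  shows "\<exists>i<length xs. P (xs ! i) \<and> \<not> P (xs ! (Suc i mod length xs))"
proof (rule ccontr)
  assume "\<not> ?thesis"
  then have step: "P (xs ! (Suc i mod length xs))" if "i < length xs" "P (xs ! i)" for i
    using that by blast
  obtain j k where j: "j < length xs" "P (xs ! j)" and k: "k < length xs" "\<not> P (xs ! k)"
    using assms by (metis in_set_conv_nth)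
  have "P (xs ! ((j + m) mod length xs))" for m
  proof (induction m)
    case (Suc m)
    have "(j + m) mod length xs < length xs"
      using k(1) by (intro mod_less_divisor) linarith
    from step[OF this Suc] show ?case
      by (simp add: mod_Suc_eq)
  qed (use j in simp)
  \<comment> \<open>This many steps lead from \<open>j\<close> past the end of the list and on to
    \<open>k\<close>, whichever of the two is larger.\<close>
  from this[of "length xs - j + k"] show False
    using j k by simp
qed

text \<open>A cycle that meets both sides has an exit from \<open>P\<close> and, by the same
  argument for the complement, an entry; these are different steps since they start on different
  sides.\<close>

lemma cyclic_changes_ge_2:
  assumes "x \<in> set xs" "P x" "y \<in> set xs" "\<not> P y"
  shows "card (cyclic_changes P xs) \<ge> 2"
proof -
  obtain i where i: "i < length xs" "P (xs ! i)" "\<not> P (xs ! (Suc i mod length xs))"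
    using cyclic_change_exists[OF assms] by blast
  obtain j where j: "j < length xs" "\<not> P (xs ! j)" "P (xs ! (Suc j mod length xs))"
    using cyclic_change_exists[of y xs "\<lambda>z. \<not> P z" x] assms by blast
  have "{i, j} \<subseteq> cyclic_changes P xs"
    using i j by (auto simp: cyclic_changes_def)
  then have "card {i, j} \<le> card (cyclic_changes P xs)"
    by (intro card_mono finite_cyclic_changes)
  moreover have "i \<noteq> j"
    using i j by blast
  ultimately show ?thesis
    by simp
qed

text \<open>The indices satisfying \<open>P\<close> form an interval, which is left at most once
  (set \<open>A\<close>) and entered at most once (set \<open>B\<close>).\<close>

lemma cyclic_changes_le_2:
  assumes first: "\<not> P (xs ! 0)"
    and convex: "\<And>i j k. i \<le> j \<Longrightarrow> j \<le> k \<Longrightarrow> k < length xs \<Longrightarrow> P (xs ! i) \<Longrightarrow> P (xs ! k) \<Longrightarrow> P (xs ! j)"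
  shows "card (cyclic_changes P xs) \<le> 2"
proof -
  define A where "A = {i \<in> cyclic_changes P xs. P (xs ! i)}"
  define B where "B = {i \<in> cyclic_changes P xs. \<not> P (xs ! i)}"
  have A: "\<not> i < j" if "i \<in> A" "j \<in> A" for i j
  proof
    assume "i < j"
    moreover have "j < length xs" "P (xs ! i)" "P (xs ! j)" "\<not> P (xs ! (Suc i mod length xs))"
      using that by (auto simp: A_def cyclic_changes_def)
    ultimately show False
      using convex[of i "Suc i" j] by simp
  qed
  have B: "\<not> i < j" if "i \<in> B" "j \<in> B" for i j
  proof
    assume "i < j"
    moreover have j: "j < length xs" "\<not> P (xs ! j)" "P (xs ! (Suc i mod length xs))"
      "P (xs ! (Suc j mod length xs))"
      using that by (auto simp: B_def cyclic_changes_def)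
    \<comment> \<open>If \<open>j\<close> were the last index, its successor would be the first
      entry, where \<open>P\<close> fails. So no entry happens at the wrap-around.\<close>
    moreover have "Suc j < length xs"
      using j first by (metis Suc_lessI mod_self)
    ultimately show False
      using convex[of "Suc i" j "Suc j"] by simp
  qed
  have "finite A" "finite B"
    by (simp_all add: A_def B_def finite_cyclic_changes)
  moreover have "\<forall>i\<in>A. \<forall>j\<in>A. i = j" "\<forall>i\<in>B. \<forall>j\<in>B. i = j"
    using A B by (meson linorder_neqE_nat)+
  ultimately have "card A \<le> 1" "card B \<le> 1"
    by (simp_all add: card_le_Suc0_iff_eq)
  moreover have "cyclic_changes P xs = A \<union> B"
    by (auto simp: A_def B_def)
  ultimately show ?thesis
    using card_Un_le[of A B] by simp
qed

section \<open>The cost of the lexicographic tour\<close>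

text \<open>A word between two words with first letter \<open>c\<close> is nonempty and starts with
  \<open>c\<close> itself, and the tails are ordered in the same way. Thus a sorted tour visits each
  subtree in one run.\<close>

lemma prefix_lexorder_convex:
  fixes x y z v :: "'a::linorder list"
  assumes "x \<le> y" "y \<le> z" "prefix v x" "prefix v z"
  shows "prefix v y"
  using assms
proof (induction v arbitrary: x y z)
  case (Cons c v)
  from Cons.prems(3,4) obtain x' z' where "x = c # x'" "z = c # z'" "prefix v x'" "prefix v z'"
    by (auto simp: prefix_def)
  then show ?case
    using Cons.prems(1,2) Cons.IH[of x' "tl y" z'] by (cases y) auto
qed simp

text \<open>Exchange of summation between the steps of the tour and the edges of the tree.\<close>

lemma hst_tour_cost_eq:
  assumes "set xs \<subseteq> hst_vertices b \<delta>"
  shows "tour_cost (hst_dist b \<delta> lam) xs =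
    (\<Sum>v\<in>hst_vertices b \<delta> - {[]}. lam ^ length v * card (cyclic_changes (prefix v) xs))"
proof -
  have mem: "xs ! i \<in> hst_vertices b \<delta>" if "i < length xs" for i
    using that assms by auto
  have count: "(\<Sum>i<length xs. of_bool (P (xs ! i) \<noteq> P (xs ! (Suc i mod length xs))) :: real) =
      card (cyclic_changes P xs)" for P :: "nat list \<Rightarrow> bool"
    by (auto simp: cyclic_changes_def lessThan_def Int_def simp flip: sum.inter_filter
        intro!: arg_cong[where f = card])
  have "tour_cost (hst_dist b \<delta> lam) xs = (\<Sum>i<length xs. \<Sum>v\<in>hst_vertices b \<delta> - {[]}.
      lam ^ length v * of_bool (prefix v (xs ! i) \<noteq> prefix v (xs ! (Suc i mod length xs))))"
    unfolding tour_cost_def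
  proof (intro sum.cong refl hst_dist_eq mem)
    fix i assume i: "i \<in> {..<length xs}"
    then show "i < length xs"
      by simp
    from i show "Suc i mod length xs < length xs"
      by (intro mod_less_divisor) auto
  qed
  also have "\<dots> = (\<Sum>v\<in>hst_vertices b \<delta> - {[]}. \<Sum>i<length xs.
      lam ^ length v * of_bool (prefix v (xs ! i) \<noteq> prefix v (xs ! (Suc i mod length xs))))"
    by (rule sum.swap)
  also have "\<dots> = (\<Sum>v\<in>hst_vertices b \<delta> - {[]}. lam ^ length v * card (cyclic_changes (prefix v) xs))"
    by (simp only: count flip: sum_distrib_left)
  finally show ?thesis .
qed

text \<open>With nonnegative weights, bounds on the separate crossing counts add up.
  \<open>lower\<close> concerns every tour and \<open>upper\<close> the single tour
  \<open>s\<close>, so \<open>s\<close> attains the minimum.\<close>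

lemma hst_min_tour_cost_eq:
  assumes W: "set_mset W \<subseteq> hst_vertices b \<delta>" and lam: "0 \<le> lam"
  shows "min_tour_cost (hst_dist b \<delta> lam) (add_mset hst_root W) =
    (\<Sum>v\<in>hst_vertices b \<delta> - {[]}. lam ^ length v * (2 * of_bool (\<exists>w\<in>#W. prefix v w)))"
    (is "_ = ?S")
proof -
  have mset_tour: "set xs = insert [] (set_mset W)"
    if "xs \<in> permutations_of_multiset (add_mset hst_root W)" for xs
    using that by (metis permutations_of_multisetD set_mset_add_mset_insert set_mset_mset hst_root_def)
  have subset: "insert [] (set_mset W) \<subseteq> hst_vertices b \<delta>"
    using W by (auto simp: hst_vertices_def)
  have lower: "?S \<le> tour_cost (hst_dist b \<delta> lam) xs"
    if xs: "xs \<in> permutations_of_multiset (add_mset hst_root W)" for xs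
  proof -
    \<comment> \<open>The root \<open>[]\<close> is on the tour and lies outside the subtree below
      \<open>v\<close>, so a point of \<open>W\<close> inside forces two crossings.\<close>
    have "2 * of_bool (\<exists>w\<in>#W. prefix v w) \<le> card (cyclic_changes (prefix v) xs)"
      if "v \<noteq> []" for v
      using cyclic_changes_ge_2[of _ xs "prefix v" "[]"] mset_tour[OF xs] that by auto
    then have "real (2 * of_bool (\<exists>w\<in>#W. prefix v w)) \<le> card (cyclic_changes (prefix v) xs)"
      if "v \<noteq> []" for v
      using that of_nat_mono by blast
    then show ?thesis
      using subset lam mset_tour[OF xs]
      by (subst hst_tour_cost_eq) (auto intro!: sum_mono mult_left_mono)
  qed
  define s where "s = sorted_list_of_multiset (add_mset hst_root W)"
  have s_tour: "s \<in> permutations_of_multiset (add_mset hst_root W)"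
    by (simp add: s_def permutations_of_multiset_def)
  have sorted: "sorted s"
    unfolding s_def by (rule sorted_sorted_list_of_multiset)
  \<comment> \<open>The empty word is the lexicographic minimum, so the sorted tour starts at the
    root, outside every subtree considered.\<close>
  have s0: "s ! 0 = []"
  proof -
    obtain i where i: "i < length s" "s ! i = []"
      using mset_tour[OF s_tour] by (metis in_set_conv_nth insertI1)
    then have "s ! 0 \<le> s ! i"
      by (intro sorted_nth_mono sorted) auto
    then show ?thesis
      using i by simp
  qed
  have upper: "card (cyclic_changes (prefix v) s) \<le> 2 * of_bool (\<exists>w\<in>#W. prefix v w)"
    if v: "v \<noteq> []" for v
  proof (cases "\<exists>w\<in>#W. prefix v w")
    case True
    have "card (cyclic_changes (prefix v) s) \<le> 2"
    proof (rule cyclic_changes_le_2)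
      show "prefix v (s ! j)"
        if "i \<le> j" "j \<le> k" "k < length s" "prefix v (s ! i)" "prefix v (s ! k)" for i j k
        using that
        by (intro prefix_lexorder_convex[of "s ! i" "s ! j" "s ! k"] sorted_nth_mono sorted) auto
    qed (use s0 v in auto)
    with True show ?thesis
      by simp
  next
    case False
    then have "\<not> prefix v (s ! i)" if "i < length s" for i
      using mset_tour[OF s_tour] v that by (metis insertE nth_mem prefix_Nil)
    moreover have "Suc i mod length s < length s" if "i < length s" for i
      using that by (intro mod_less_divisor) linarith
    ultimately have "cyclic_changes (prefix v) s = {}"
      by (simp add: cyclic_changes_def)
    then show ?thesis
      by simp
  qed
  then have "real (card (cyclic_changes (prefix v) s)) \<le> 2 * of_bool (\<exists>w\<in>#W. prefix v w)"
    if "v \<noteq> []" for v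
    using of_nat_mono[OF upper[OF that], where 'a = real] by simp
  then have "tour_cost (hst_dist b \<delta> lam) s \<le> ?S"
    using subset lam mset_tour[OF s_tour]
    by (subst hst_tour_cost_eq) (auto intro!: sum_mono mult_left_mono)
  with lower[OF s_tour] have "tour_cost (hst_dist b \<delta> lam) s = ?S"
    by simp
  with s_tour lower show ?thesis
    unfolding min_tour_cost_def by (intro Min_eqI) (auto intro: rev_image_eqI)
qed

section \<open>Expectation\<close>

text \<open>Fubini for the indicator of a rectangle.\<close>

lemma measure_pair_pmf_Times:
  "measure (pair_pmf M N) (A \<times> B) = measure M A * measure N B"
proof -
  have "emeasure (pair_pmf M N) (A \<times> B) = emeasure M A * emeasure N B"
    by (simp add: nn_integral_pair_pmf' indicator_times nn_integral_cmult nn_integral_multc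
        flip: nn_integral_indicator)
  then show ?thesis
    by (simp add: measure_def enn2real_mult)
qed

text \<open>The first draw is independent of the remaining ones, and the event is a rectangle in
  this splitting.\<close>

lemma prob_replicate_pmf_subset:
  "measure_pmf.prob (replicate_pmf n p) {xs. set xs \<subseteq> A} = measure_pmf.prob p A ^ n"
proof (induction n)
  case (Suc n)
  have "replicate_pmf (Suc n) p = map_pmf (\<lambda>(x, xs). x # xs) (pair_pmf p (replicate_pmf n p))"
    by (simp add: pair_pmf_def map_bind_pmf)
  then have "measure_pmf.prob (replicate_pmf (Suc n) p) {xs. set xs \<subseteq> A} =
      measure_pmf.prob (pair_pmf p (replicate_pmf n p)) (A \<times> {xs. set xs \<subseteq> A})"
    by (auto intro!: arg_cong2[where f = measure])
  then show ?case
    using Suc by (simp only: measure_pair_pmf_Times power_Suc)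
qed simp

section \<open>Counting leaves below a vertex and vertices on a level\<close>

lemma hst_leaves_eq: "hst_leaves b \<delta> = {v. set v \<subseteq> {..<b} \<and> length v = \<delta>}"
  by (auto simp: hst_leaves_def hst_vertices_def)

text \<open>Appending to \<open>v\<close> is a bijection from the words of the remaining length onto
  these leaves.\<close>

lemma card_hst_leaves_below:
  assumes "v \<in> hst_vertices b \<delta>"
  shows "card {w \<in> hst_leaves b \<delta>. prefix v w} = b ^ (\<delta> - length v)"
proof -
  have "{w \<in> hst_leaves b \<delta>. prefix v w} =
      (@) v ` {u. set u \<subseteq> {..<b} \<and> length u = \<delta> - length v}"
    using assms by (auto simp: hst_leaves_eq hst_vertices_def prefix_def)
  then show ?thesis
    by (simp add: card_image card_lists_length_eq inj_on_def)
qed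

lemma prob_leaf_not_below:
  assumes "b \<ge> 1" "v \<in> hst_vertices b \<delta>"
  shows "measure_pmf.prob (pmf_of_set (hst_leaves b \<delta>)) {w. \<not> prefix v w} = 1 - 1 / real b ^ length v"
proof -
  have fin: "finite (hst_leaves b \<delta>)"
    unfolding hst_leaves_eq by (simp add: finite_lists_length_eq)
  have card: "card (hst_leaves b \<delta>) = b ^ \<delta>"
    unfolding hst_leaves_eq by (simp add: card_lists_length_eq)
  with assms(1) have ne: "hst_leaves b \<delta> \<noteq> {}"
    by auto
  have "length v \<le> \<delta>"
    using assms(2) by (simp add: hst_vertices_def)
  have "measure_pmf.prob (pmf_of_set (hst_leaves b \<delta>)) {w. prefix v w} = 1 / real b ^ length v"
  proof -
    have "hst_leaves b \<delta> \<inter> {w. prefix v w} = {w \<in> hst_leaves b \<delta>. prefix v w}"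
      by auto
    then have "measure_pmf.prob (pmf_of_set (hst_leaves b \<delta>)) {w. prefix v w} =
        real b ^ (\<delta> - length v) / real b ^ \<delta>"
      by (simp add: measure_pmf_of_set[OF ne fin] card card_hst_leaves_below[OF assms(2)])
    also have "\<dots> = 1 / real b ^ length v"
      using assms(1) \<open>length v \<le> \<delta>\<close> by (simp add: power_diff)
    finally show ?thesis .
  qed
  moreover have "{w. \<not> prefix v w} = UNIV - {w. prefix v w}"
    by auto
  ultimately show ?thesis
    using measure_pmf.prob_compl[of "{w. prefix v w}" "pmf_of_set (hst_leaves b \<delta>)"] by simp
qed

text \<open>Grouping by level, with \<open>b ^ l\<close> words of length \<open>l\<close>; level 0
  consists of the excluded root only.\<close>

lemma sum_hst_vertices_level:
  fixes g :: "nat \<Rightarrow> real"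
  shows "(\<Sum>v\<in>hst_vertices b \<delta> - {[]}. g (length v)) = (\<Sum>l = 1..\<delta>. real b ^ l * g l)"
proof -
  have "(\<Sum>v\<in>hst_vertices b \<delta> - {[]}. g (length v)) =
      (\<Sum>l = 1..\<delta>. \<Sum>v | v \<in> hst_vertices b \<delta> - {[]} \<and> length v = l. g (length v))"
  proof (rule sum.group[symmetric])
    show "length ` (hst_vertices b \<delta> - {[]}) \<subseteq> {1..\<delta>}"
      by (auto simp: hst_vertices_def Suc_le_eq)
  qed (simp_all add: finite_hst_vertices)
  also have "\<dots> = (\<Sum>l = 1..\<delta>. real b ^ l * g l)"
  proof (intro sum.cong refl)
    fix l assume "l \<in> {1..\<delta>}"
    then have "{v \<in> hst_vertices b \<delta> - {[]}. length v = l} = {v. set v \<subseteq> {..<b} \<and> length v = l}"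
      by (auto simp: hst_vertices_def)
    then show "(\<Sum>v | v \<in> hst_vertices b \<delta> - {[]} \<and> length v = l. g (length v)) = real b ^ l * g l"
      by (simp add: card_lists_length_eq)
  qed
  finally show ?thesis .
qed

theorem theorem5:
  fixes b \<delta> n :: nat and lam :: real
  assumes "b \<ge> 2" and "\<delta> \<ge> 1" and "0 < lam" and "lam < 1"
  shows "measure_pmf.expectation (random_leaves b \<delta> n)
           (\<lambda>W. min_tour_cost (hst_dist b \<delta> lam) (add_mset hst_root W)) =
         2 * (\<Sum>l = 1..\<delta>. (real b * lam) ^ l * (1 - (1 - 1 / real b ^ l) ^ n))"
proof -
  define L where "L = replicate_pmf n (pmf_of_set (hst_leaves b \<delta>))"
  let ?V = "hst_vertices b \<delta> - {[]}"
  have "finite (hst_leaves b \<delta>)"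
    unfolding hst_leaves_eq by (simp add: finite_lists_length_eq)
  moreover have "replicate \<delta> 0 \<in> hst_leaves b \<delta>"
    using assms(1) by (auto simp: hst_leaves_eq)
  ultimately have "set_pmf (pmf_of_set (hst_leaves b \<delta>)) = hst_leaves b \<delta>"
    by (intro set_pmf_of_set) auto
  then have sample: "set ws \<subseteq> hst_vertices b \<delta>" if "ws \<in> set_pmf L" for ws
    using that by (auto simp: L_def set_replicate_pmf hst_leaves_def)
  \<comment> \<open>The complementary event is that all \<open>n\<close> independent draws miss the
    subtree below \<open>v\<close>.\<close>
  have hit: "measure_pmf.expectation L (\<lambda>ws. of_bool (\<exists>w\<in>set ws. prefix v w) :: real) =
      1 - (1 - 1 / real b ^ length v) ^ n" if "v \<in> ?V" for v
  proof -
    have "(\<lambda>ws. of_bool (\<exists>w\<in>set ws. prefix v w) :: real) =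
        indicator (UNIV - {ws. set ws \<subseteq> {w. \<not> prefix v w}})"
      by (auto simp: indicator_def fun_eq_iff)
    then have "measure_pmf.expectation L (\<lambda>ws. of_bool (\<exists>w\<in>set ws. prefix v w) :: real) =
        measure_pmf.prob L (UNIV - {ws. set ws \<subseteq> {w. \<not> prefix v w}})"
      by simp
    also have "\<dots> = 1 - measure_pmf.prob L {ws. set ws \<subseteq> {w. \<not> prefix v w}}"
      using measure_pmf.prob_compl[of "{ws. set ws \<subseteq> {w. \<not> prefix v w}}" L] by simp
    also have "\<dots> = 1 - (1 - 1 / real b ^ length v) ^ n"
      using that assms(1) by (simp add: L_def prob_replicate_pmf_subset prob_leaf_not_below)
    finally show ?thesis .
  qed
  have "measure_pmf.expectation (random_leaves b \<delta> n)
          (\<lambda>W. min_tour_cost (hst_dist b \<delta> lam) (add_mset hst_root W)) =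
        measure_pmf.expectation L
          (\<lambda>ws. min_tour_cost (hst_dist b \<delta> lam) (add_mset hst_root (mset ws)))"
    by (simp add: random_leaves_def L_def)
  \<comment> \<open>The formula for the minimum is stated for multisets of vertices, so the
    integrands are compared on the support of \<open>L\<close>.\<close>
  also have "\<dots> = measure_pmf.expectation L
      (\<lambda>ws. \<Sum>v\<in>?V. lam ^ length v * (2 * of_bool (\<exists>w\<in>set ws. prefix v w)))"
    using assms(3) sample
    by (intro integral_cong_AE) (auto simp: AE_measure_pmf_iff hst_min_tour_cost_eq)
  also have "\<dots> = (\<Sum>v\<in>?V. lam ^ length v *
      (2 * measure_pmf.expectation L (\<lambda>ws. of_bool (\<exists>w\<in>set ws. prefix v w))))"
  proof -
    \<comment> \<open>Boundedness by 1 gives the integrability that linearity of expectation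
      requires.\<close>
    have "integrable (measure_pmf L) (\<lambda>ws. of_bool (\<exists>w\<in>set ws. prefix v w) :: real)" for v
      by (rule measure_pmf.integrable_const_bound[where B = 1]) auto
    then show ?thesis
      by simp
  qed
  also have "\<dots> = (\<Sum>v\<in>?V. lam ^ length v * (2 * (1 - (1 - 1 / real b ^ length v) ^ n)))"
    by (intro sum.cong refl) (simp only: hit)
  also have "\<dots> = (\<Sum>l = 1..\<delta>. real b ^ l * (lam ^ l * (2 * (1 - (1 - 1 / real b ^ l) ^ n))))"
    by (rule sum_hst_vertices_level)
  also have "\<dots> = 2 * (\<Sum>l = 1..\<delta>. (real b * lam) ^ l * (1 - (1 - 1 / real b ^ l) ^ n))"
    unfolding sum_distrib_left by (intro sum.cong refl) (simp add: power_mult_distrib)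
  finally show ?thesis .
qed

end
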